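(* Statement (A) implies statement (B), where: (A) For every matrix $M$ with non-negative real entries, every odd positive integer $t$, and all pairwise distinct positions $(x_1,y_1),\dots,(x_t,y_t)$ in $M$ such that $M_{x_iy_i}=0$ for all $i=1,\dots,t$, one has $$\sum_{i=1}^{t}\sum_{j=1}^{t} M_{x_iy_j}M_{x_jy_i} \le (t-1)\,\|M\|_\infty\,\|M\|_1 .$$ (B) For all positive integers $n,k$ and every $n\times k$ matrix $M$ with non-negative integer entries, all row sums equal to $k$ and all column sums equal to $n$, the (non-bipartite, $nk$-regular) multigraph on the $nk$ vertices $[n]\times[k]$ with adjacency matrix $M\otimes M^T$ has a perfect matching.
   Context: $\|M\|_\infty$ is the maximum of the $\ell^1$-norms of the rows of $M$, and $\|M\|_1=\|M^T\|_\infty$ is the maximum of the $\ell^1$-norms of the columns of $M$. For an $n\times k$ matrix $M$, in this statement $M\otimes M^T$ denotes the symmetric $nk\times nk$ matrix with rows and columns indexed by pairs $(x,y)\in[n]\times[k]$ and entries $(M\otimes M^T)((x_1,y_1),(x_2,y_2)) := M(x_1,y_2)\,M(x_2,y_1)$ (this is not exactly the usual tensor product). The multigraph with this adjacency matrix may have loops (a nonzero diagonal entry gives a loop). A perfect matching in a (multi)graph with vertex set $V$ is an involution $\theta$ on $V$ (a map with $\theta^2=\mathrm{id}$, fixed points allowed) such that for every $v\in V$ there is an edge between $v$ and $\theta(v)$; in particular a vertex with a loop may be matched to itself. *)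

theory Defs
  imports Complex_Main "Jordan_Normal_Form.Matrix"
begin

text \<open>The maximum is over the rows, so the value is only meaningful if there is at least one row.\<close>

definition norm_inf_mat :: "real mat \<Rightarrow> real" where
  "norm_inf_mat M = Max ((\<lambda>i. \<Sum>j<dim_col M. \<bar>M $$ (i, j)\<bar>) ` {..<dim_row M})"

definition norm_one_mat :: "real mat \<Rightarrow> real" where
  "norm_one_mat M = norm_inf_mat (transpose_mat M)"

text \<open>The matrix $M \otimes M^T$, whose rows and columns are indexed by pairs. With this
  indexing it differs from the Kronecker product: the two column indices are crossed over.\<close>

definition tensor_transpose :: "'a::times mat \<Rightarrow> nat \<times> nat \<Rightarrow> nat \<times> nat \<Rightarrow> 'a" where
  "tensor_transpose M = (\<lambda>(x1, y1) (x2, y2). M $$ (x1, y2) * M $$ (x2, y1))"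

text \<open>A multigraph is given by its vertex set \<open>V\<close> and its adjacency matrix \<open>A\<close>, where \<open>A u v\<close>
  is the number of edges between \<open>u\<close> and \<open>v\<close> (for \<open>u = v\<close>, the number of loops at \<open>u\<close>, each
  counted once). The matching is a map rather than a set of edges, so that a vertex with a loop
  can be matched to itself. Values of \<open>\<theta>\<close> outside \<open>V\<close> are irrelevant.\<close>

definition is_perfect_matching ::
    "'v set \<Rightarrow> ('v \<Rightarrow> 'v \<Rightarrow> nat) \<Rightarrow> ('v \<Rightarrow> 'v) \<Rightarrow> bool" where
  "is_perfect_matching V A \<theta> \<longleftrightarrow>
     (\<forall>v\<in>V. \<theta> v \<in> V) \<and> (\<forall>v\<in>V. \<theta> (\<theta> v) = v) \<and> (\<forall>v\<in>V. A v (\<theta> v) > 0)"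

definition has_perfect_matching :: "'v set \<Rightarrow> ('v \<Rightarrow> 'v \<Rightarrow> nat) \<Rightarrow> bool" where
  "has_perfect_matching V A \<longleftrightarrow> (\<exists>\<theta>. is_perfect_matching V A \<theta>)"

lemma tensor_transpose_sym:
  fixes M :: "'a::ab_semigroup_mult mat"
  shows "tensor_transpose M p q = tensor_transpose M q p"
  by (simp add: tensor_transpose_def split_beta mult.commute)

lemma tensor_transpose_regular:
  fixes M :: "nat mat"
  assumes rows: "\<And>i. i < n \<Longrightarrow> (\<Sum>j<k. M $$ (i, j)) = k"
    and cols: "\<And>j. j < k \<Longrightarrow> (\<Sum>i<n. M $$ (i, j)) = n"
    and p: "p \<in> {..<n} \<times> {..<k}"
  shows "(\<Sum>q\<in>{..<n} \<times> {..<k}. tensor_transpose M p q) = n * k"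
proof -
  obtain x y where [simp]: "p = (x, y)" by (cases p)
  have "(\<Sum>q\<in>{..<n} \<times> {..<k}. tensor_transpose M p q)
      = (\<Sum>x2<n. \<Sum>y2<k. M $$ (x, y2) * M $$ (x2, y))"
    by (simp add: sum.cartesian_product tensor_transpose_def split_beta)
  also have "\<dots> = (\<Sum>x2<n. M $$ (x2, y)) * (\<Sum>y2<k. M $$ (x, y2))"
    by (simp add: sum_product mult.commute)
  also have "\<dots> = n * k"
    using rows[of x] cols[of y] p by simp
  finally show ?thesis .
qed

end

theory Submission
  imports Defs
begin

text \<open>
  The implication is an application of the Tutte--Berge theorem for graphs with loops, proved
  here in the form \<open>tutte_berge_loops\<close>. If a graph has no perfect matching, there are a vertex set
  \<open>S\<close> and more than \<open>card S\<close> disjoint, loopless sets of odd size outside \<open>S\<close>, each of which has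
  edges only to itself and to \<open>S\<close>. In the graph of \<open>M \<otimes> M\<^sup>T\<close> a set of \<open>t\<close> vertices is loopless
  exactly if \<open>M\<close> vanishes at the corresponding \<open>t\<close> positions, and the double sum in the norm
  inequality is the total degree inside the set. The norms are \<open>k\<close> and \<open>n\<close>, so for odd \<open>t\<close> this
  degree is at most \<open>(t - 1) \<cdot> n \<cdot> k\<close>. The graph is \<open>nk\<close>-regular, so every one of the odd sets
  sends at least \<open>nk\<close> edges to \<open>S\<close>. That is more edges than the regularity of \<open>S\<close> permits
  (\<open>regular_sparse_has_perfect_matching\<close>).

  Loops are treated as edges that cover a single vertex, and a maximum matching is one that
  covers the most vertices. With this convention the proof of the Tutte--Berge theorem
  by Gallai's lemma carries over without a reduction to simple graphs. If deleting some vertex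
  reduces the number of covered vertices by at least two, that vertex goes into \<open>S\<close>, and induction
  applies to the rest. Otherwise \<open>S\<close> is empty: on the vertices that some maximum matching misses,
  being missed only one at a time is an equivalence relation (\<open>inseparable_trans\<close>), no edge leaves
  this vertex set (\<open>missable_closed\<close>), and the equivalence classes are the odd sets. The first two
  of these facts come from the same exchange of one edge (\<open>exchange\<close>).
\<close>

section \<open>Matchings with loops and the exchange argument\<close>

text \<open>Edges are the sets \<open>{a, b}\<close>, so a loop is a singleton. The size of a matching \<open>N\<close> is measured
  below by \<open>card (\<Union>N)\<close> rather than \<open>card N\<close>, which makes a loop count for one vertex and any other
  edge for two.\<close>

definition matching :: "'v set \<Rightarrow> ('v \<Rightarrow> 'v \<Rightarrow> bool) \<Rightarrow> 'v set set \<Rightarrow> bool" where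
  "matching V E N \<longleftrightarrow> N \<subseteq> {{a, b} | a b. a \<in> V \<and> b \<in> V \<and> E a b} \<and> pairwise disjnt N"

lemma matching_empty: "matching V E {}"
  by (simp add: matching_def)

lemma matching_subset:
  assumes "matching V E N" "P \<subseteq> N"
  shows "matching V E P"
  using assms unfolding matching_def by (meson pairwise_subset subset_trans)

lemma matching_Union_subset: "matching V E N \<Longrightarrow> \<Union>N \<subseteq> V"
  unfolding matching_def by fastforce

lemma matching_finite:
  assumes "finite V" "matching V E N"
  shows "finite N"
  using assms matching_Union_subset by (metis finite_UnionD finite_subset)

lemma matching_finite_Union:
  assumes "finite V" "matching V E N"
  shows "finite (\<Union>N)"
  using assms matching_Union_subset by (metis finite_subset)

lemma matching_edgeE:
  assumes "matching V E N" "e \<in> N" "x \<in> e" "symp E"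
  obtains y where "e = {x, y}" "y \<in> V" "E x y"
proof -
  obtain a b where ab: "e = {a, b}" "a \<in> V" "b \<in> V" "E a b"
    using assms(1,2) unfolding matching_def by blast
  show thesis
  proof (cases "x = a")
    case True
    then show thesis using that ab by blast
  next
    case False
    with ab assms(3) have "x = b" by simp
    then show thesis using that[of a] ab sympD[OF assms(4)] by blast
  qed
qed

lemma matching_edge_unique:
  assumes "matching V E N" "e \<in> N" "f \<in> N" "x \<in> e" "x \<in> f"
  shows "e = f"
  using assms unfolding matching_def pairwise_def disjnt_def by blast

lemma matching_insert:
  assumes "matching V E N" "a \<in> V" "b \<in> V" "E a b" "a \<notin> \<Union>N" "b \<notin> \<Union>N"
  shows "matching V E (insert {a, b} N)"
  using assms unfolding matching_def by (auto simp: pairwise_insert disjnt_def)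

lemma matching_mono:
  assumes "matching V E N" "V \<subseteq> W"
  shows "matching W E N"
  using assms unfolding matching_def by blast

text \<open>This single exchange argument carries the whole duality theorem. Among the largest
  matchings avoiding \<open>t\<close>, take one that shares as many edges with \<open>N\<close> as possible. If \<open>N\<close> covered
  two further vertices, one of them would be some \<open>x \<noteq> t\<close>; putting the \<open>N\<close>-edge \<open>{x, y}\<close> in the
  place of the edge that currently covers \<open>y\<close> keeps \<open>t\<close> uncovered and loses no coverage, but has
  one more edge in common with \<open>N\<close>. If instead \<open>y\<close> is uncovered, then \<open>{x, y}\<close> can simply be added:
  for a loop this violates the bound \<open>q\<close>, and otherwise, where \<open>y\<close> may be \<open>t\<close> itself, the bound
  \<open>q + 1\<close>.\<close>

lemma exchange:
  assumes fin: "finite V" and sym: "symp E" and N: "matching V E N"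
    and P: "matching V E P" "t \<notin> \<Union>P" "card (\<Union>P) = q"
    and max_t: "\<And>Q. matching V E Q \<Longrightarrow> t \<notin> \<Union>Q \<Longrightarrow> card (\<Union>Q) \<le> q"
    and max_all: "\<And>Q. matching V E Q \<Longrightarrow> card (\<Union>Q) \<le> q + 1"
  obtains Q where "matching V E Q" "t \<notin> \<Union>Q" "card (\<Union>Q) = q" "card (\<Union>N - \<Union>Q) \<le> 1"
proof -
  define good where "good Q \<longleftrightarrow> matching V E Q \<and> t \<notin> \<Union>Q \<and> card (\<Union>Q) = q" for Q
  have finN: "finite N" using matching_finite[OF fin N] .
  have "\<exists>Q. good Q \<and> (\<forall>Q'. good Q' \<longrightarrow> card (N \<inter> Q') \<le> card (N \<inter> Q))"
    by (rule ex_has_greatest_nat[of good P _ "card N + 1"])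
      (use P finN in \<open>auto simp: good_def less_Suc_eq_le intro: card_mono\<close>)
  then obtain Q where Q: "matching V E Q" "t \<notin> \<Union>Q" "card (\<Union>Q) = q"
    and best: "\<And>Q'. good Q' \<Longrightarrow> card (N \<inter> Q') \<le> card (N \<inter> Q)"
    unfolding good_def by blast
  have finQ: "finite (\<Union>Q)"
    by (rule matching_finite_Union[OF fin Q(1)])
  have "card (\<Union>N - \<Union>Q) \<le> 1"
  proof (rule ccontr)
    assume "\<not> card (\<Union>N - \<Union>Q) \<le> 1"
    then have "\<not> \<Union>N - \<Union>Q \<subseteq> {t}"
      using card_mono[of "{t}" "\<Union>N - \<Union>Q"] by auto
    then obtain x e where x: "x \<noteq> t" "x \<notin> \<Union>Q" "e \<in> N" "x \<in> e" by blast
    obtain y where y: "e = {x, y}" "y \<in> V" "E x y"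
      using matching_edgeE[OF N x(3,4) sym] by blast
    have xV: "x \<in> V" using matching_Union_subset[OF N] x by blast
    show False
    proof (cases "y \<in> \<Union>Q")
      case False
      have m: "matching V E (insert e Q)"
        using matching_insert[OF Q(1) xV y(2,3) x(2) False] y(1) by simp
      have U: "\<Union>(insert e Q) = insert x (insert y (\<Union>Q))" using y(1) by blast
      show False
      proof (cases "y = x")
        case True
        then have "t \<notin> \<Union>(insert e Q)" "card (\<Union>(insert e Q)) = q + 1"
          unfolding U using Q(2,3) x(1,2) finQ by simp_all
        with max_t[OF m] show False by simp
      next
        case neq: False
        have "card (\<Union>(insert e Q)) = q + 2"
          unfolding U using neq False x(2) finQ Q(3) by simp
        with max_all[OF m] show False by simp
      qed
    next
      case True
      then obtain f where f: "f \<in> Q" "y \<in> f" by blast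
      obtain z where z: "f = {y, z}"
        using matching_edgeE[OF Q(1) f sym] by blast
      have yx: "y \<noteq> x" "y \<noteq> t" using True x(2) Q(2) by auto
      let ?R = "Q - {f}"
      let ?Q' = "insert e ?R"
      have yR: "y \<notin> \<Union>?R" using matching_edge_unique[OF Q(1)] f by blast
      have m: "matching V E ?Q'"
        using matching_insert[OF matching_subset[OF Q(1), of ?R] xV y(2,3)] x(2) yR y(1) by blast
      have tQ': "t \<notin> \<Union>?Q'" using Q(2) x(1) yx y(1) by blast
      have "\<Union>Q = f \<union> \<Union>?R" using f by blast
      then have "q \<le> card f + card (\<Union>?R)"
        using Q(3) card_Un_le[of f "\<Union>?R"] by simp
      moreover have "card f \<le> 2" using z by (simp add: card_insert_le_m1)
      moreover have "card (\<Union>?Q') = card (\<Union>?R) + 2"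
      proof -
        have "\<Union>?Q' = insert x (insert y (\<Union>?R))" using y(1) by blast
        moreover have "finite (\<Union>?R)" using finQ by (rule finite_subset[rotated]) blast
        moreover have "x \<notin> insert y (\<Union>?R)" using yx(1) x(2) by blast
        ultimately show ?thesis using yR by simp
      qed
      ultimately have "card (\<Union>?Q') = q"
        using max_t[OF m tQ'] by linarith
      with m tQ' have "good ?Q'" by (simp add: good_def)
      moreover have "N \<inter> ?Q' = insert e (N \<inter> Q)"
      proof -
        have "f \<notin> N"
          using matching_edge_unique[OF N x(3), of f y] f x(2,4) y(1) by blast
        then show ?thesis using x(3) by blast
      qed
      moreover have "e \<notin> N \<inter> Q" using x(2,4) by blast
      ultimately show False
        using best[of ?Q'] finN by simp
    qed
  qed
  with Q that show thesis by blast
qed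

section \<open>The Tutte--Berge theorem for graphs with loops\<close>

text \<open>The sets in \<open>F\<close> play the part of the odd components of \<open>V - S\<close> in Tutte's condition, but each may
  be a union of several components. Sets that contain a loop do not count, since their parity is
  no obstruction.\<close>

definition barrier :: "'v set \<Rightarrow> ('v \<Rightarrow> 'v \<Rightarrow> bool) \<Rightarrow> 'v set \<Rightarrow> 'v set set \<Rightarrow> bool" where
  "barrier V E S F \<longleftrightarrow> S \<subseteq> V \<and> pairwise disjnt F \<and>
     (\<forall>C\<in>F. C \<subseteq> V - S \<and> odd (card C) \<and> (\<forall>a\<in>C. \<not> E a a) \<and>
        (\<forall>a\<in>C. \<forall>b\<in>V - S - C. \<not> E a b))"

definition maximum_matching :: "'v set \<Rightarrow> ('v \<Rightarrow> 'v \<Rightarrow> bool) \<Rightarrow> 'v set set \<Rightarrow> bool" where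
  "maximum_matching V E N \<longleftrightarrow> matching V E N \<and>
     (\<forall>Q. matching V E Q \<longrightarrow> card (\<Union>Q) \<le> card (\<Union>N))"

lemma maximum_matching_exists:
  assumes "finite V"
  obtains N where "maximum_matching V E N"
proof -
  have "\<exists>N. matching V E N \<and> (\<forall>Q. matching V E Q \<longrightarrow> card (\<Union>Q) \<le> card (\<Union>N))"
    by (rule ex_has_greatest_nat[of _ "{}" _ "card V + 1"])
      (use assms in \<open>auto simp: matching_empty less_Suc_eq_le intro: card_mono dest: matching_Union_subset\<close>)
  with that show thesis unfolding maximum_matching_def by blast
qed

lemma maximum_matching_same_card:
  "maximum_matching V E N \<Longrightarrow> maximum_matching V E Q \<Longrightarrow> card (\<Union>Q) = card (\<Union>N)"
  by (simp add: maximum_matching_def order_antisym)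

lemma maximum_matching_uncovered_not_adjacent:
  assumes "finite V" "maximum_matching V E N" "a \<in> V - \<Union>N" "b \<in> V - \<Union>N"
  shows "\<not> E a b"
proof
  assume "E a b"
  moreover have "matching V E N" using assms(2) by (simp add: maximum_matching_def)
  ultimately have m: "matching V E (insert {a, b} N)"
    using assms(3,4) by (intro matching_insert) auto
  then have "card (\<Union>(insert {a, b} N)) \<le> card (\<Union>N)"
    using assms(2) by (simp only: maximum_matching_def)
  moreover have "\<Union>N \<subset> \<Union>(insert {a, b} N)" using assms(3) by blast
  moreover have "finite (\<Union>(insert {a, b} N))"
    by (rule matching_finite_Union[OF assms(1) m])
  ultimately show False using psubset_card_mono leD by metis
qed

text \<open>The relation in Gallai's lemma. It need not be transitive on all vertices, because a vertex
  covered by every maximum matching is related to everything.\<close>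

definition inseparable :: "'v set \<Rightarrow> ('v \<Rightarrow> 'v \<Rightarrow> bool) \<Rightarrow> 'v \<Rightarrow> 'v \<Rightarrow> bool" where
  "inseparable V E u v \<longleftrightarrow>
     u = v \<or> (\<forall>N. maximum_matching V E N \<longrightarrow> u \<in> \<Union>N \<or> v \<in> \<Union>N)"

definition missable :: "'v set \<Rightarrow> ('v \<Rightarrow> 'v \<Rightarrow> bool) \<Rightarrow> 'v set" where
  "missable V E = {v \<in> V. \<exists>N. maximum_matching V E N \<and> v \<notin> \<Union>N}"

text \<open>If a maximum matching missed both \<open>u\<close> and \<open>v\<close>, exchanging towards it from one that misses
  \<open>t\<close> would give a maximum matching that still misses \<open>t\<close> and covers all but at most one of the
  same vertices, hence at most one new vertex. It would therefore miss \<open>t\<close> together with \<open>u\<close> or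
  \<open>v\<close>.\<close>

lemma inseparable_trans:
  assumes fin: "finite V" and sym: "symp E" and t: "t \<in> missable V E"
    and ut: "inseparable V E u t" and tv: "inseparable V E t v"
  shows "inseparable V E u v"
proof (rule ccontr)
  assume "\<not> inseparable V E u v"
  then obtain N where uv: "u \<noteq> v" and N: "maximum_matching V E N" "u \<notin> \<Union>N" "v \<notin> \<Union>N"
    unfolding inseparable_def by blast
  obtain P where P: "maximum_matching V E P" "t \<notin> \<Union>P"
    using t unfolding missable_def by blast
  obtain Q where Q: "matching V E Q" "t \<notin> \<Union>Q" "card (\<Union>Q) = card (\<Union>P)"
      "card (\<Union>N - \<Union>Q) \<le> 1"
  proof (rule exchange[OF fin sym, of N P t "card (\<Union>P)"])
    show "card (\<Union>R) \<le> card (\<Union>P)" if "matching V E R" for R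
      using P(1) that by (simp only: maximum_matching_def)
    then show "card (\<Union>R) \<le> card (\<Union>P) + 1" if "matching V E R" for R
      using that le_add1 le_trans by blast
  qed (use N(1) P in \<open>simp_all only: maximum_matching_def not_False_eq_True\<close>)
  have maxQ: "maximum_matching V E Q" using Q P(1) by (simp add: maximum_matching_def)
  have ne: "u \<noteq> t" "t \<noteq> v" using ut tv uv N unfolding inseparable_def by auto
  then have "u \<in> \<Union>Q" "v \<in> \<Union>Q"
    using ut tv maxQ Q(2) unfolding inseparable_def by blast+
  with N have sub: "{u, v} \<subseteq> \<Union>Q - \<Union>N" by blast
  have finU: "finite (\<Union>Q)" "finite (\<Union>N)"
    using N(1) Q(1) fin by (auto simp only: maximum_matching_def matching_finite_Union)
  then have "card (\<Union>Q - \<Union>N) = card (\<Union>N - \<Union>Q)"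
    using card_le_sym_Diff[of "\<Union>Q" "\<Union>N"] card_le_sym_Diff[of "\<Union>N" "\<Union>Q"]
      maximum_matching_same_card[OF N(1) maxQ] by simp
  moreover have "card {u, v} \<le> card (\<Union>Q - \<Union>N)"
    using sub finU by (intro card_mono) auto
  ultimately show False using uv Q(4) by simp
qed

text \<open>If every maximum matching covered \<open>w\<close>, the matching in \<open>deletable\<close> would cover exactly one
  vertex less than a maximum one. Exchanging it towards a maximum matching that misses \<open>u\<close> makes
  the two differ so little that both miss \<open>u\<close>. The smaller one then misses \<open>u\<close> and \<open>w\<close>, and adding
  the edge between them covers more vertices than is possible.\<close>

lemma missable_closed:
  assumes fin: "finite V" and sym: "symp E" and u: "u \<in> missable V E"
    and w: "w \<in> V" "E u w" and N0: "maximum_matching V E N0"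
    and deletable: "\<exists>P. matching V E P \<and> w \<notin> \<Union>P \<and> card (\<Union>N0) \<le> card (\<Union>P) + 1"
  shows "w \<in> missable V E"
proof (rule ccontr)
  assume nw: "w \<notin> missable V E"
  obtain N where N: "maximum_matching V E N" "u \<notin> \<Union>N"
    using u unfolding missable_def by blast
  have uV: "u \<in> V" using u by (simp add: missable_def)
  obtain P where P: "matching V E P" "w \<notin> \<Union>P" "card (\<Union>N0) \<le> card (\<Union>P) + 1"
    using deletable by blast
  have less: "card (\<Union>Q) < card (\<Union>N0)" if "matching V E Q" "w \<notin> \<Union>Q" for Q
  proof (rule ccontr)
    assume "\<not> card (\<Union>Q) < card (\<Union>N0)"
    then have "maximum_matching V E Q"
      using that(1) N0 unfolding maximum_matching_def by (meson le_trans linorder_not_less)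
    then show False using that(2) nw w(1) by (auto simp: missable_def)
  qed
  have eq: "card (\<Union>N0) = card (\<Union>P) + 1" using less[OF P(1,2)] P(3) by simp
  obtain Q where Q: "matching V E Q" "w \<notin> \<Union>Q" "card (\<Union>Q) = card (\<Union>P)"
      "card (\<Union>N - \<Union>Q) \<le> 1"
  proof (rule exchange[OF fin sym, of N P w "card (\<Union>P)"])
    fix R assume R: "matching V E R"
    then show "card (\<Union>R) \<le> card (\<Union>P) + 1"
      using N0 eq by (metis maximum_matching_def)
    assume "w \<notin> \<Union>R"
    from less[OF R this] eq show "card (\<Union>R) \<le> card (\<Union>P)" by simp
  qed (use N(1) P in \<open>simp_all only: maximum_matching_def not_False_eq_True\<close>)
  have finU: "finite (\<Union>Q)" "finite (\<Union>N)"
    using N(1) Q(1) fin by (auto simp only: maximum_matching_def matching_finite_Union)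
  have "card (\<Union>N) = card (\<Union>Q) + 1"
    using maximum_matching_same_card[OF N0 N(1)] eq Q(3) by simp
  moreover have "card (\<Union>N) = card (\<Union>N \<inter> \<Union>Q) + card (\<Union>N - \<Union>Q)"
    and "card (\<Union>Q) = card (\<Union>N \<inter> \<Union>Q) + card (\<Union>Q - \<Union>N)"
    using finU by (metis card_Int_Diff, metis card_Int_Diff Int_commute)
  ultimately have "\<Union>Q - \<Union>N = {}" using Q(4) finU by simp
  then have uQ: "u \<notin> \<Union>Q" using N(2) by blast
  have m: "matching V E (insert {u, w} Q)"
    using matching_insert[OF Q(1) uV w uQ Q(2)] .
  have "u \<noteq> w" using u nw by blast
  then have "card (\<Union>(insert {u, w} Q)) = card (\<Union>Q) + 2"
    using uQ Q(2) finU by simp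
  moreover have "card (\<Union>(insert {u, w} Q)) \<le> card (\<Union>N0)"
    using m N0 unfolding maximum_matching_def by blast
  ultimately show False using eq Q(3) by simp
qed

text \<open>Edges at \<open>C\<close> stay inside \<open>C\<close> and are not loops, so \<open>N\<close> pairs off \<open>C - {v}\<close>.\<close>

lemma odd_card_if_closed:
  assumes fin: "finite V" and sym: "symp E" and N: "matching V E N"
    and C: "v \<in> C" "C \<subseteq> V" "v \<notin> \<Union>N" "C - {v} \<subseteq> \<Union>N"
    and noloop: "\<And>a. a \<in> C \<Longrightarrow> \<not> E a a"
    and closed: "\<And>a b. a \<in> C \<Longrightarrow> b \<in> V \<Longrightarrow> E a b \<Longrightarrow> b \<in> C"
  shows "odd (card C)"
proof -
  let ?N = "{e \<in> N. e \<inter> C \<noteq> {}}"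
  have edge: "e \<subseteq> C \<and> card e = 2" if e: "e \<in> N" "a \<in> e" "a \<in> C" for e a
  proof -
    obtain b where b: "e = {a, b}" "b \<in> V" "E a b"
      using matching_edgeE[OF N e(1,2) sym] .
    then have "b \<in> C" "a \<noteq> b" using closed[OF e(3)] noloop[OF e(3)] by auto
    with b e(3) show ?thesis by simp
  qed
  have U: "\<Union>?N = C - {v}"
  proof (intro equalityI subsetI)
    fix a assume "a \<in> \<Union>?N"
    then obtain e c where "e \<in> N" "a \<in> e" "c \<in> e" "c \<in> C" by blast
    with edge C(3) show "a \<in> C - {v}" by blast
  next
    fix a assume "a \<in> C - {v}"
    with C(4) show "a \<in> \<Union>?N" by blast
  qed
  have "card (\<Union>?N) = (\<Sum>e\<in>?N. card e)"
  proof (rule card_Union_disjoint)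
    show "pairwise disjnt ?N"
      using N unfolding matching_def by (auto intro: pairwise_subset)
    fix e assume "e \<in> ?N"
    then have "card e = 2" using edge by blast
    then show "finite e" by (simp add: card_ge_0_finite)
  qed
  also have "\<dots> = (\<Sum>e\<in>?N. 2)"
  proof (rule sum.cong)
    fix e assume "e \<in> ?N"
    then show "card e = 2" using edge by blast
  qed simp
  finally have "even (card (C - {v}))" unfolding U by simp
  moreover have "card C = Suc (card (C - {v}))"
    using C fin finite_subset by (metis card_Suc_Diff1)
  ultimately show ?thesis by simp
qed

text \<open>The odd sets are the classes of inseparable missable vertices. No edge leaves a class, because
  neighbours of missable vertices are missable and adjacent vertices are inseparable; a maximum
  matching missing \<open>v\<close> covers everything else in the class of \<open>v\<close>; and the vertices missed by \<open>N\<close>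
  lie in distinct classes. No class contains a loop, since a maximum matching never misses a
  vertex with a loop.\<close>

lemma gallai_classes_barrier:
  assumes fin: "finite V" and sym: "symp E" and N: "maximum_matching V E N"
    and deletable:
      "\<And>w. w \<in> V \<Longrightarrow> \<exists>P. matching V E P \<and> w \<notin> \<Union>P \<and> card (\<Union>N) \<le> card (\<Union>P) + 1"
  obtains F where "barrier V E {} F" "card (V - \<Union>N) \<le> card F"
proof -
  let ?D = "missable V E"
  define cls where "cls v = {w \<in> ?D. inseparable V E v w}" for v
  have DV: "?D \<subseteq> V" by (auto simp: missable_def)
  have self: "v \<in> cls v" if "v \<in> ?D" for v
    using that by (simp add: cls_def inseparable_def)
  have isym: "inseparable V E b a" if "inseparable V E a b" for a b
    using that unfolding inseparable_def by blast
  have cls_eq: "cls a = cls b" if "a \<in> ?D" "b \<in> ?D" "inseparable V E a b" for a b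
    unfolding cls_def using that inseparable_trans[OF fin sym] isym by blast
  have adj: "inseparable V E a b" if "a \<in> V" "b \<in> V" "E a b" for a b
    using that maximum_matching_uncovered_not_adjacent[OF fin]
    unfolding inseparable_def by blast
  have closed: "b \<in> cls v" if "v \<in> ?D" "a \<in> cls v" "b \<in> V" "E a b" for v a b
  proof -
    have a: "a \<in> ?D" "inseparable V E v a" using that(2) by (auto simp: cls_def)
    have "b \<in> ?D"
      by (rule missable_closed[OF fin sym a(1) that(3,4) N deletable[OF that(3)]])
    moreover have "inseparable V E v b"
      using inseparable_trans[OF fin sym a(1) a(2)] adj a(1) DV that(3,4) by blast
    ultimately show ?thesis by (simp add: cls_def)
  qed
  have noloop: "\<not> E a a" if "a \<in> ?D" for a
    using that maximum_matching_uncovered_not_adjacent[OF fin] unfolding missable_def by blast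
  have odd_cls: "odd (card (cls v))" if v: "v \<in> ?D" for v
  proof -
    obtain Q where Q: "maximum_matching V E Q" "v \<notin> \<Union>Q"
      using v by (auto simp: missable_def)
    show ?thesis
    proof (rule odd_card_if_closed[OF fin sym])
      show "matching V E Q" using Q(1) by (simp add: maximum_matching_def)
      show "v \<in> cls v" by (rule self[OF v])
      show "cls v \<subseteq> V" using DV by (auto simp: cls_def)
      show "cls v - {v} \<subseteq> \<Union>Q" using Q unfolding cls_def inseparable_def by blast
      show "\<not> E a a" if "a \<in> cls v" for a using noloop that by (simp add: cls_def)
    qed (use Q(2) closed[OF v] in auto)
  qed
  have "pairwise disjnt (cls ` ?D)"
  proof (rule pairwiseI)
    fix X Y assume "X \<in> cls ` ?D" "Y \<in> cls ` ?D" "X \<noteq> Y"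
    then obtain a b where ab: "a \<in> ?D" "b \<in> ?D" "X = cls a" "Y = cls b" "cls a \<noteq> cls b" by blast
    have "cls a \<inter> cls b = {}"
    proof (rule ccontr)
      assume "cls a \<inter> cls b \<noteq> {}"
      then obtain c where "c \<in> ?D" "inseparable V E a c" "inseparable V E b c"
        by (auto simp: cls_def)
      with ab(1,2,5) cls_eq show False by metis
    qed
    with ab show "disjnt X Y" by (simp add: disjnt_def)
  qed
  moreover have "cls v \<subseteq> ?D" for v by (auto simp: cls_def)
  moreover have "\<not> E a b" if "v \<in> ?D" "a \<in> cls v" "b \<in> V - cls v" for v a b
    using closed[OF that(1,2)] that(3) by blast
  ultimately have "barrier V E {} (cls ` ?D)"
    unfolding barrier_def using DV noloop odd_cls by simp (meson subset_iff)
  moreover have "card (V - \<Union>N) \<le> card (cls ` ?D)"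
  proof -
    have sub: "V - \<Union>N \<subseteq> ?D" using N by (auto simp: missable_def)
    have "inj_on cls (V - \<Union>N)"
    proof (rule inj_onI)
      fix a b assume ab: "a \<in> V - \<Union>N" "b \<in> V - \<Union>N" "cls a = cls b"
      then have "b \<in> cls a" using self sub by blast
      then show "a = b" using ab N by (auto simp: cls_def inseparable_def)
    qed
    then have "card (V - \<Union>N) = card (cls ` (V - \<Union>N))" by (simp add: card_image)
    also have "\<dots> \<le> card (cls ` ?D)"
      using fin DV sub by (intro card_mono finite_imageI image_mono) (auto intro: finite_subset)
    finally show ?thesis .
  qed
  ultimately show thesis by (rule that)
qed

text \<open>If deleting \<open>w\<close> loses at least two covered vertices, then at least one more vertex is uncovered
  among the rest, so a barrier of the rest has an odd set to spare, which pays for moving \<open>w\<close> into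
  \<open>S\<close>. If there is no such \<open>w\<close>, the Gallai classes form a barrier.\<close>

theorem tutte_berge_loops:
  assumes "finite V" and sym: "symp E" and "maximum_matching V E N"
  shows "\<exists>S F. barrier V E S F \<and> card S + card (V - \<Union>N) \<le> card F"
  using assms(1,3)
proof (induction "card V" arbitrary: V N rule: less_induct)
  case less
  show ?case
  proof (cases "\<forall>w\<in>V. \<exists>P. matching V E P \<and> w \<notin> \<Union>P \<and> card (\<Union>N) \<le> card (\<Union>P) + 1")
    case True
    then obtain F where "barrier V E {} F" "card (V - \<Union>N) \<le> card F"
      using gallai_classes_barrier[OF less.prems(1) sym less.prems(2)] by blast
    then show ?thesis by (metis add_0 card.empty)
  next
    case False
    then obtain w where w: "w \<in> V"
      and drop: "\<And>P. matching V E P \<Longrightarrow> w \<notin> \<Union>P \<Longrightarrow> card (\<Union>P) + 1 < card (\<Union>N)"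
      by (meson linorder_not_less)
    let ?W = "V - {w}"
    have finW: "finite ?W" using less.prems(1) by simp
    obtain P where P: "maximum_matching ?W E P" using maximum_matching_exists[OF finW] .
    have "card ?W < card V" using card_Diff1_less[OF less.prems(1) w] .
    from less.hyps[OF this finW P] obtain S F
      where SF: "barrier ?W E S F" "card S + card (?W - \<Union>P) \<le> card F" by blast
    have mP: "matching ?W E P" using P by (simp add: maximum_matching_def)
    have PW: "\<Union>P \<subseteq> ?W" by (rule matching_Union_subset[OF mP])
    have NV: "\<Union>N \<subseteq> V"
      using less.prems(2) unfolding maximum_matching_def by (blast dest: matching_Union_subset)
    have "card (\<Union>P) + 1 < card (\<Union>N)"
      using drop[OF matching_mono[OF mP]] PW by blast
    moreover have "card (?W - \<Union>P) = card V - 1 - card (\<Union>P)"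
      using PW finW w by (simp add: card_Diff_subset finite_subset)
    moreover have "card (V - \<Union>N) = card V - card (\<Union>N)"
      using NV less.prems(1) by (simp add: card_Diff_subset finite_subset)
    moreover have "card (\<Union>N) \<le> card V"
      using NV less.prems(1) by (simp add: card_mono)
    ultimately have "card (V - \<Union>N) + 1 \<le> card (?W - \<Union>P)" by linarith
    moreover have "card (insert w S) \<le> card S + 1" by (simp add: card_insert_le_m1)
    ultimately have "card (insert w S) + card (V - \<Union>N) \<le> card F" using SF(2) by linarith
    moreover have "barrier V E (insert w S) F"
    proof -
      have "V - insert w S = ?W - S" by blast
      then show ?thesis using SF(1) w unfolding barrier_def by auto
    qed
    ultimately show ?thesis by blast
  qed
qed

section \<open>Regular multigraphs whose odd loopless sets span few edges\<close>

lemma covering_matching_perfect: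
  fixes A :: "'v \<Rightarrow> 'v \<Rightarrow> nat"
  assumes sym: "\<And>u v. A u v = A v u"
    and N: "matching V (\<lambda>u v. 0 < A u v) N" and cover: "\<Union>N = V"
  shows "has_perfect_matching V A"
proof -
  let ?E = "\<lambda>u v. 0 < A u v"
  have symE: "symp ?E" by (rule sympI) (simp only: sym)
  have uniq: "w = w'" if "{v, w} \<in> N" "{v, w'} \<in> N" for v w w'
    using matching_edge_unique[OF N that, of v] by (auto simp: doubleton_eq_iff)
  have ex: "\<exists>w. {v, w} \<in> N \<and> w \<in> V \<and> ?E v w" if v: "v \<in> V" for v
  proof -
    obtain e where e: "e \<in> N" "v \<in> e" using v cover by blast
    from matching_edgeE[OF N e symE] e(1) show ?thesis by metis
  qed
  define \<theta> where "\<theta> v = (THE w. {v, w} \<in> N)" for v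
  have eq: "\<theta> v = w" if "{v, w} \<in> N" for v w
    unfolding \<theta>_def using that uniq by (intro the_equality) auto
  have "is_perfect_matching V A \<theta>"
    unfolding is_perfect_matching_def
  proof (intro conjI ballI)
    fix v assume "v \<in> V"
    then obtain w where w: "{v, w} \<in> N" "w \<in> V" "?E v w" using ex by blast
    then have "\<theta> v = w" "\<theta> w = v" using eq by (auto simp: insert_commute)
    with w show "\<theta> v \<in> V" "\<theta> (\<theta> v) = v" "0 < A v (\<theta> v)" by auto
  qed
  then show ?thesis by (auto simp: has_perfect_matching_def)
qed

text \<open>An odd set of a barrier has total degree \<open>d \<cdot> card C\<close>, of which at most \<open>d \<cdot> (card C - 1)\<close> stays
  inside; so it sends at least \<open>d\<close> edges to \<open>S\<close>. As \<open>S\<close> has only \<open>d \<cdot> card S\<close> edge ends, a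
  barrier has at most \<open>card S\<close> odd sets.\<close>

lemma regular_sparse_has_perfect_matching:
  fixes A :: "'v \<Rightarrow> 'v \<Rightarrow> nat"
  assumes fin: "finite V" and sym: "\<And>u v. A u v = A v u" and d: "0 < d"
    and regular: "\<And>u. u \<in> V \<Longrightarrow> (\<Sum>v\<in>V. A u v) = d"
    and sparse: "\<And>C. C \<subseteq> V \<Longrightarrow> odd (card C) \<Longrightarrow> (\<And>a. a \<in> C \<Longrightarrow> A a a = 0) \<Longrightarrow>
      (\<Sum>u\<in>C. \<Sum>v\<in>C. A u v) \<le> (card C - 1) * d"
  shows "has_perfect_matching V A"
proof -
  let ?E = "\<lambda>u v. 0 < A u v"
  have symE: "symp ?E" by (rule sympI) (simp only: sym)
  obtain N where N: "maximum_matching V ?E N" using maximum_matching_exists[OF fin] .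
  obtain S F where SF: "barrier V ?E S F" and big: "card S + card (V - \<Union>N) \<le> card F"
    using tutte_berge_loops[OF fin symE N] by blast
  have SV: "S \<subseteq> V" and disj: "pairwise disjnt F" and FV: "\<And>C. C \<in> F \<Longrightarrow> C \<subseteq> V - S"
    using SF unfolding barrier_def by auto
  have finS: "finite S" using SV fin by (rule finite_subset)
  have finC: "finite C" if "C \<in> F" for C using FV[OF that] fin finite_subset by blast
  have finF: "finite F"
  proof (rule finite_subset)
    show "F \<subseteq> Pow V" using FV by blast
  qed (simp add: fin)
  have out: "d \<le> (\<Sum>u\<in>C. \<Sum>s\<in>S. A u s)" if C: "C \<in> F" for C
  proof -
    have "odd (card C)" and loop: "\<And>a. a \<in> C \<Longrightarrow> A a a = 0"
      and iso: "\<And>a b. a \<in> C \<Longrightarrow> b \<in> V - S - C \<Longrightarrow> A a b = 0"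
      using SF C unfolding barrier_def by auto
    then have inner: "(\<Sum>u\<in>C. \<Sum>v\<in>C. A u v) \<le> (card C - 1) * d"
      using sparse FV[OF C] by blast
    have row: "(\<Sum>v\<in>C. A u v) + (\<Sum>s\<in>S. A u s) = d" if u: "u \<in> C" for u
    proof -
      have "(\<Sum>v\<in>C. A u v) + (\<Sum>s\<in>S. A u s) = (\<Sum>v\<in>C \<union> S. A u v)"
        using FV[OF C] finC[OF C] finS by (intro sum.union_disjoint[symmetric]) auto
      also have "\<dots> = (\<Sum>v\<in>V. A u v)"
        using FV[OF C] SV fin iso[OF u] by (intro sum.mono_neutral_left) auto
      finally show ?thesis using regular u FV[OF C] by auto
    qed
    have "(\<Sum>u\<in>C. \<Sum>v\<in>C. A u v) + (\<Sum>u\<in>C. \<Sum>s\<in>S. A u s) = card C * d"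
      using row by (simp flip: sum.distrib)
    moreover have "card C * d = (card C - 1) * d + d"
      using \<open>odd (card C)\<close> by (cases "card C") auto
    ultimately show ?thesis using inner by linarith
  qed
  have "card F * d \<le> (\<Sum>C\<in>F. \<Sum>u\<in>C. \<Sum>s\<in>S. A u s)"
    using sum_mono[OF out] by simp
  also have "\<dots> = (\<Sum>u\<in>\<Union>F. \<Sum>s\<in>S. A u s)"
    using disj finC by (subst sum.Union_disjoint) (auto simp: pairwise_def disjnt_def)
  also have "\<dots> \<le> (\<Sum>u\<in>V. \<Sum>s\<in>S. A u s)"
    using FV fin by (intro sum_mono2) auto
  also have "\<dots> = (\<Sum>s\<in>S. \<Sum>u\<in>V. A s u)"
    using sym by (subst sum.swap) simp
  also have "\<dots> = card S * d" using regular SV by (simp add: subset_iff)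
  finally have "card F \<le> card S" using d by simp
  with big have "card (V - \<Union>N) = 0" by linarith
  then have "V - \<Union>N = {}" using fin by simp
  moreover have "matching V ?E N" using N by (simp add: maximum_matching_def)
  ultimately show ?thesis
    using covering_matching_perfect[of A, OF sym] matching_Union_subset by blast
qed

section \<open>From the norm inequality to perfect matchings\<close>

lemma norm_inf_mat_constant_row_sums:
  assumes "0 < dim_row M"
    and "\<And>i. i < dim_row M \<Longrightarrow> (\<Sum>j<dim_col M. \<bar>M $$ (i, j)\<bar>) = c"
  shows "norm_inf_mat M = c"
proof -
  have "(\<lambda>i. \<Sum>j<dim_col M. \<bar>M $$ (i, j)\<bar>) ` {..<dim_row M} = {c}"
    using assms by auto
  then show ?thesis by (simp add: norm_inf_mat_def)
qed

theorem theorem4: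
  assumes "\<forall>(M::real mat) (t::nat) (x::nat \<Rightarrow> nat) (y::nat \<Rightarrow> nat).
      (\<forall>i<dim_row M. \<forall>j<dim_col M. 0 \<le> M $$ (i, j)) \<and>
      odd t \<and>
      (\<forall>i\<in>{1..t}. x i < dim_row M \<and> y i < dim_col M) \<and>
      inj_on (\<lambda>i. (x i, y i)) {1..t} \<and>
      (\<forall>i\<in>{1..t}. M $$ (x i, y i) = 0)
    \<longrightarrow> (\<Sum>i=1..t. \<Sum>j=1..t. M $$ (x i, y j) * M $$ (x j, y i))
          \<le> (real t - 1) * norm_inf_mat M * norm_one_mat M"
  shows "\<forall>(n::nat) (k::nat) (M::nat mat).
      0 < n \<and> 0 < k \<and>
      M \<in> carrier_mat n k \<and>
      (\<forall>i<n. (\<Sum>j<k. M $$ (i, j)) = k) \<and>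
      (\<forall>j<k. (\<Sum>i<n. M $$ (i, j)) = n)
    \<longrightarrow> has_perfect_matching ({..<n} \<times> {..<k}) (tensor_transpose M)"
proof (intro allI impI)
  fix n k :: nat and M :: "nat mat"
  assume "0 < n \<and> 0 < k \<and> M \<in> carrier_mat n k \<and>
      (\<forall>i<n. (\<Sum>j<k. M $$ (i, j)) = k) \<and> (\<forall>j<k. (\<Sum>i<n. M $$ (i, j)) = n)"
  then have pos: "0 < n" "0 < k" and dim: "dim_row M = n" "dim_col M = k"
    and rows: "\<And>i. i < n \<Longrightarrow> (\<Sum>j<k. M $$ (i, j)) = k"
    and cols: "\<And>j. j < k \<Longrightarrow> (\<Sum>i<n. M $$ (i, j)) = n"
    by auto
  let ?V = "{..<n} \<times> {..<k}"
  let ?R = "map_mat real M"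
  have norm_inf: "norm_inf_mat ?R = real k"
    using pos dim rows
    by (intro norm_inf_mat_constant_row_sums) (auto simp flip: of_nat_sum)
  have norm_one: "norm_one_mat ?R = real n"
    unfolding norm_one_mat_def using pos dim cols
    by (intro norm_inf_mat_constant_row_sums) (auto simp flip: of_nat_sum)
  show "has_perfect_matching ?V (tensor_transpose M)"
  proof (rule regular_sparse_has_perfect_matching)
    show "finite ?V" by simp
    show "tensor_transpose M u v = tensor_transpose M v u" for u v
      by (rule tensor_transpose_sym)
    show "0 < n * k" using pos by simp
    show "(\<Sum>v\<in>?V. tensor_transpose M u v) = n * k" if "u \<in> ?V" for u
      using tensor_transpose_regular[OF rows cols that] by simp
    fix C assume C: "C \<subseteq> ?V" and odd: "odd (card C)"
      and loop: "\<And>a. a \<in> C \<Longrightarrow> tensor_transpose M a a = 0"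
    have "finite C" using C by (rule finite_subset) simp
    then obtain h where h: "bij_betw h {1..card C} C"
      using ex_bij_betw_nat_finite_1 by blast
    let ?x = "\<lambda>i. fst (h i)" and ?y = "\<lambda>i. snd (h i)"
    have hC: "h i \<in> C" if "i \<in> {1..card C}" for i
      using h that by (auto dest: bij_betwE)
    have inV: "?x i < n" "?y i < k" if "i \<in> {1..card C}" for i
      using hC[OF that] C by auto
    have zero: "?R $$ (?x i, ?y i) = 0" if "i \<in> {1..card C}" for i
      using loop[OF hC[OF that]] inV[OF that] dim
      by (cases "h i") (simp add: tensor_transpose_def)
    have "(\<Sum>u\<in>C. \<Sum>v\<in>C. tensor_transpose M u v)
        = (\<Sum>i=1..card C. \<Sum>j=1..card C. tensor_transpose M (h i) (h j))"
      by (simp add: sum.reindex_bij_betw[OF h, symmetric])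
    then have "real (\<Sum>u\<in>C. \<Sum>v\<in>C. tensor_transpose M u v)
        = (\<Sum>i=1..card C. \<Sum>j=1..card C. ?R $$ (?x i, ?y j) * ?R $$ (?x j, ?y i))"
      using inV dim by (simp add: tensor_transpose_def split_beta)
    also have "\<dots> \<le> (real (card C) - 1) * norm_inf_mat ?R * norm_one_mat ?R"
    proof (rule assms[rule_format], intro conjI)
      show "inj_on (\<lambda>i. (?x i, ?y i)) {1..card C}"
        using h by (simp add: bij_betw_def)
    qed (use odd inV zero dim in auto)
    also have "\<dots> = real ((card C - 1) * (n * k))"
      unfolding norm_inf norm_one using odd by (simp add: of_nat_diff odd_pos Suc_leI mult_ac)
    finally show "(\<Sum>u\<in>C. \<Sum>v\<in>C. tensor_transpose M u v) \<le> (card C - 1) * (n * k)"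
      by (simp only: of_nat_le_iff)
  qed
qed

end
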